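(* For every WTS $\mathcal{M}=(S,\rightarrow,\ell)$ and all $s,t\in S$, if $s\sim_W t$ then $s\sim t$. Moreover the inclusion is strict in general: there exist a WTS and states $s,t$ of it with $s\sim t$ but not $s\sim_W t$.
   Context: Fix a set $\mathcal{AP}$ of atomic propositions. A weighted transition system (WTS) is a triple $\mathcal{M}=(S,\rightarrow,\ell)$ where $S$ is a non-empty set of states, $\rightarrow\subseteq S\times\mathbb{R}_{\ge 0}\times S$ is a transition relation (write $s\xrightarrow{r}t$), and $\ell:S\to 2^{\mathcal{AP}}$ is a labeling. For $s\in S$, $T\subseteq S$ let $\theta(s)(T)=\{r\mid \exists t\in T,\ s\xrightarrow{r}t\}$; $\theta^-(s)(T)=-\infty$ if $\theta(s)(T)=\emptyset$, else $\inf\theta(s)(T)$; $\theta^+(s)(T)=\infty$ if $\theta(s)(T)=\emptyset$, else $\sup\theta(s)(T)$. A weighted bisimulation relation on $\mathcal{M}$ is an equivalence relation $\mathcal{R}$ on $S$ such that whenever $s\mathcal{R}t$: $\ell(s)=\ell(t)$; if $s\xrightarrow{r}s'$ then there is $t'$ with $t\xrightarrow{r}t'$ and $s'\mathcal{R}t'$; and if $t\xrightarrow{r}t'$ then there is $s'$ with $s\xrightarrow{r}s'$ and $s'\mathcal{R}t'$. $s\sim_W t$ iff some weighted bisimulation relation relates $s$ and $t$. A generalized weighted bisimulation relation on $\mathcal{M}$ is an equivalence relation $\mathcal{R}$ on $S$ such that whenever $s\mathcal{R}t$: $\ell(s)=\ell(t)$, and for every $\mathcal{R}$-equivalence class $T$,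 $\theta^-(s)(T)=\theta^-(t)(T)$ and $\theta^+(s)(T)=\theta^+(t)(T)$. $s\sim t$ iff some generalized weighted bisimulation relation relates $s$ and $t$. *)

theory Defs
  imports Complex_Main "HOL-Library.Extended_Real"
begin

record ('s, 'p) wts =
  states :: "'s set"
  transitions :: "('s \<times> real \<times> 's) set"
  labels :: "'s \<Rightarrow> 'p set"

text \<open>Only the values of \<^term>\<open>labels M\<close> on \<^term>\<open>states M\<close> are meaningful.\<close>

definition is_wts :: "'p set \<Rightarrow> ('s, 'p) wts \<Rightarrow> bool" where
  "is_wts AP M \<longleftrightarrow>
     states M \<noteq> {} \<and>
     transitions M \<subseteq> states M \<times> {0..} \<times> states M \<and>
     labels M ` states M \<subseteq> Pow AP"

definition \<theta> :: "('s, 'p) wts \<Rightarrow> 's \<Rightarrow> 's set \<Rightarrow> real set" where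
  "\<theta> M s T = {r. \<exists>t\<in>T. (s, r, t) \<in> transitions M}"

text \<open>
  Bounds are taken in the extended reals, so an unbounded set of weights has supremum \<open>\<infinity>\<close>.
  The values on the empty set are the opposite of the order-theoretic ones
  (\<open>Inf {} = \<infinity>\<close>, \<open>Sup {} = -\<infinity>\<close>).
\<close>

definition \<theta>_min :: "('s, 'p) wts \<Rightarrow> 's \<Rightarrow> 's set \<Rightarrow> ereal" where
  "\<theta>_min M s T = (if \<theta> M s T = {} then -\<infinity> else Inf (ereal ` \<theta> M s T))"

definition \<theta>_max :: "('s, 'p) wts \<Rightarrow> 's \<Rightarrow> 's set \<Rightarrow> ereal" where
  "\<theta>_max M s T = (if \<theta> M s T = {} then \<infinity> else Sup (ereal ` \<theta> M s T))"

definition weighted_bisimulation :: "('s, 'p) wts \<Rightarrow> 's rel \<Rightarrow> bool" where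
  "weighted_bisimulation M R \<longleftrightarrow>
     equiv (states M) R \<and>
     (\<forall>s t. (s, t) \<in> R \<longrightarrow>
        labels M s = labels M t \<and>
        (\<forall>r s'. (s, r, s') \<in> transitions M \<longrightarrow>
           (\<exists>t'. (t, r, t') \<in> transitions M \<and> (s', t') \<in> R)) \<and>
        (\<forall>r t'. (t, r, t') \<in> transitions M \<longrightarrow>
           (\<exists>s'. (s, r, s') \<in> transitions M \<and> (s', t') \<in> R)))"

definition weighted_bisimilar :: "('s, 'p) wts \<Rightarrow> 's \<Rightarrow> 's \<Rightarrow> bool" where
  "weighted_bisimilar M s t \<longleftrightarrow> (\<exists>R. weighted_bisimulation M R \<and> (s, t) \<in> R)"

definition gen_weighted_bisimulation :: "('s, 'p) wts \<Rightarrow> 's rel \<Rightarrow> bool" where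
  "gen_weighted_bisimulation M R \<longleftrightarrow>
     equiv (states M) R \<and>
     (\<forall>s t. (s, t) \<in> R \<longrightarrow>
        labels M s = labels M t \<and>
        (\<forall>T \<in> states M // R. \<theta>_min M s T = \<theta>_min M t T \<and> \<theta>_max M s T = \<theta>_max M t T))"

definition gen_weighted_bisimilar :: "('s, 'p) wts \<Rightarrow> 's \<Rightarrow> 's \<Rightarrow> bool" where
  "gen_weighted_bisimilar M s t \<longleftrightarrow> (\<exists>R. gen_weighted_bisimulation M R \<and> (s, t) \<in> R)"

end

theory Submission
  imports Defs
begin

text \<open>Matching moves of a weighted bisimulation carry the same weight and end in the same
  class. Hence related states have identical weight sets into every class
  (\<open>weighted_bisimulation_\<theta>_eq\<close>), and so identical bounds: the same relation is
  a generalized weighted bisimulation. The converse fails because infimum and supremum forget the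
  weights strictly between them; \<open>gap_wts\<close> exploits this with the weight sets {0, 1, 2}
  and {0, 2}.\<close>

lemma weighted_bisimulation_\<theta>_subset:
  assumes bisim: "weighted_bisimulation M R" and R: "(s, t) \<in> R"
    and T: "T \<in> states M // R"
  shows "\<theta> M s T \<subseteq> \<theta> M t T"
proof
  fix r
  assume "r \<in> \<theta> M s T"
  then obtain u where u: "u \<in> T" "(s, r, u) \<in> transitions M"
    by (auto simp: \<theta>_def)
  then obtain v where v: "(t, r, v) \<in> transitions M" "(u, v) \<in> R"
    using bisim R unfolding weighted_bisimulation_def by blast
  have "equiv (states M) R"
    using bisim by (simp add: weighted_bisimulation_def)
  \<comment> \<open>Classes are closed under \<open>R\<close>, so the matching move of
    \<open>t\<close> also ends in \<open>T\<close>.\<close>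
  then have "v \<in> T"
    using T u(1) v(2) by (rule in_quotient_imp_closed)
  then show "r \<in> \<theta> M t T"
    using v(1) by (auto simp: \<theta>_def)
qed

text \<open>Symmetry of \<open>R\<close> turns the one-sided inclusion into an equality.\<close>

lemma weighted_bisimulation_\<theta>_eq:
  assumes "weighted_bisimulation M R" "(s, t) \<in> R" "T \<in> states M // R"
  shows "\<theta> M s T = \<theta> M t T"
proof -
  have "(t, s) \<in> R"
    using assms(1,2) by (auto simp: weighted_bisimulation_def equiv_def dest: symD)
  then show ?thesis
    using assms by (intro equalityI weighted_bisimulation_\<theta>_subset)
qed

text \<open>Both bounds, including their default values on the empty set, depend only on the weight
  set.\<close>

lemma weighted_bisimulation_imp_gen:
  assumes "weighted_bisimulation M R"
  shows "gen_weighted_bisimulation M R"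
  using assms weighted_bisimulation_\<theta>_eq[OF assms]
  by (simp add: gen_weighted_bisimulation_def weighted_bisimulation_def \<theta>_min_def \<theta>_max_def)

lemma weighted_bisimilar_imp_gen:
  "weighted_bisimilar M s t \<Longrightarrow> gen_weighted_bisimilar M s t"
  unfolding weighted_bisimilar_def gen_weighted_bisimilar_def
  using weighted_bisimulation_imp_gen by blast

text \<open>State 0 has an intermediate weight that state 1 lacks and that the bounds do not detect.\<close>

definition gap_wts :: "(nat, 'p) wts" where
  "gap_wts = \<lparr>states = {0, 1},
              transitions = {0} \<times> {0, 1, 2} \<times> {0} \<union> {1} \<times> {0, 2} \<times> {0},
              labels = (\<lambda>_. {})\<rparr>"

lemma is_wts_gap_wts: "is_wts AP gap_wts"
  by (auto simp: is_wts_def gap_wts_def)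

lemma gen_weighted_bisimilar_gap_wts:
  "gen_weighted_bisimilar (gap_wts :: (nat, 'p) wts) 0 1"
proof -
  let ?M = "gap_wts :: (nat, 'p) wts"
  \<comment> \<open>The total relation has a single class, so the bounds need comparing for one
    target set only.\<close>
  let ?R = "{0, 1} \<times> {0, 1 :: nat}"
  have "equiv {0, 1} ?R"
    by (auto simp: equiv_def refl_on_def sym_def trans_def)
  moreover have "{0, 1} // ?R = {{0, 1}}"
    by (auto simp: quotient_def)
  moreover have "\<theta> ?M 0 {0, 1} = {0, 1, 2}" "\<theta> ?M 1 {0, 1} = {0, 2}"
    by (auto simp: \<theta>_def gap_wts_def)
  then have "\<theta>_min ?M 0 {0, 1} = \<theta>_min ?M 1 {0, 1}"
    "\<theta>_max ?M 0 {0, 1} = \<theta>_max ?M 1 {0, 1}"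
    \<comment> \<open>Bounds of a finite set unfold to binary \<open>inf\<close> and
      \<open>sup\<close>, which on the linearly ordered extended reals are \<open>min\<close> and
      \<open>max\<close>.\<close>
    by (simp_all add: \<theta>_min_def \<theta>_max_def inf_min sup_max)
  ultimately have "gen_weighted_bisimulation ?M ?R"
    by (auto simp: gen_weighted_bisimulation_def gap_wts_def)
  then show ?thesis
    unfolding gen_weighted_bisimilar_def by blast
qed

lemma not_weighted_bisimilar_gap_wts:
  "\<not> weighted_bisimilar (gap_wts :: (nat, 'p) wts) 0 1"
proof
  let ?M = "gap_wts :: (nat, 'p) wts"
  assume "weighted_bisimilar ?M 0 1"
  \<comment> \<open>Whatever the relation, state 1 cannot answer this move: it has no transition of
    weight 1.\<close>
  moreover have "(0, 1, 0) \<in> transitions ?M"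
    by (simp add: gap_wts_def)
  ultimately obtain t where "(1, 1, t) \<in> transitions ?M"
    unfolding weighted_bisimilar_def weighted_bisimulation_def by blast
  then show False
    by (simp add: gap_wts_def)
qed

theorem theorem2p12:
  fixes AP :: "'p set"
  shows "(\<forall>M :: ('s, 'p) wts. is_wts AP M \<longrightarrow>
            (\<forall>s\<in>states M. \<forall>t\<in>states M.
               weighted_bisimilar M s t \<longrightarrow> gen_weighted_bisimilar M s t)) \<and>
         (\<exists>M :: (nat, 'p) wts. is_wts AP M \<and>
            (\<exists>s\<in>states M. \<exists>t\<in>states M.
               gen_weighted_bisimilar M s t \<and> \<not> weighted_bisimilar M s t))"
proof (intro conjI exI)
  let ?M = "gap_wts :: (nat, 'p) wts"
  show "\<forall>M :: ('s, 'p) wts. is_wts AP M \<longrightarrow>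
          (\<forall>s\<in>states M. \<forall>t\<in>states M.
             weighted_bisimilar M s t \<longrightarrow> gen_weighted_bisimilar M s t)"
    by (intro allI impI ballI weighted_bisimilar_imp_gen)
  show "is_wts AP ?M"
    by (rule is_wts_gap_wts)
  have "0 \<in> states ?M" "1 \<in> states ?M"
    by (simp_all add: gap_wts_def)
  then show "\<exists>s\<in>states ?M. \<exists>t\<in>states ?M.
      gen_weighted_bisimilar ?M s t \<and> \<not> weighted_bisimilar ?M s t"
    using gen_weighted_bisimilar_gap_wts not_weighted_bisimilar_gap_wts by blast
qed

end
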